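(* Suppose that $\alpha(x,y)=\frac{1}{2x+c_1(y)}$, which is of special type II. Then the induced metric on a $p$-minimal surface with this $\alpha$ as its $\alpha$-function (in compatible coordinates $(x,y)$) is given by $$a=\frac{|\alpha|\,h(y)}{\sqrt{1+\alpha^2}},\qquad b=\frac{|\alpha|\,e^{k(y)}}{\sqrt{1+\alpha^2}},$$ for some functions $h(y)$ and $k(y)$.
   Context: The Heisenberg group $H_1$ is $\mathbb{R}^3$ with the group law $(x_1,y_1,z_1)\circ(x_2,y_2,z_2)=(x_1+x_2,\,y_1+y_2,\,z_1+z_2+y_1x_2-x_1y_2)$. Left invariant fields: $\mathring e_1=\partial_x+y\partial_z$, $\mathring e_2=\partial_y-x\partial_z$, $T=\partial_z$. Contact form $\Theta=dz+x\,dy-y\,dx$, contact bundle $\xi=\ker\Theta$, $J\mathring e_1=\mathring e_2$, $J\mathring e_2=-\mathring e_1$. The adapted metric makes $\mathring e_1,\mathring e_2,T$ orthonormal; $\nabla$ is the connection for which they are parallel. All objects are $C^\infty$. For a surface $\Sigma\subset H_1$ without singular points (points with $T_p\Sigma=\xi_p$) choose a unit field $e_1\in T\Sigma\cap\xi$, $e_2=Je_1$; $H$ is defined by $\nabla_{e_1}e_2=-He_1$; $p$-minimal means $H=0$. The $\alpha$-function is defined by $\alpha e_2+T\in T\Sigma$; $\hat e_1=e_1$, $\hat e_2=\frac{\alpha e_2+T}{\sqrt{1+\alpha^2}}$ is an orthonormal frame of $T\Sigma$. Compatible coordinates $(x,y)$: $e_1=\partial_x$; then the induced metric is represented by the functions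 $a,b$ with $\hat e_2=a\,\partial_x+b\,\partial_y$, coordinates being taken with $b>0$. Coordinate domains are local, with connected $x$-slices. *)

theory Defs
  imports "HOL-Analysis.Analysis"
begin

section \<open>Smooth maps on open sets\<close>

fun Ck_on :: "nat \<Rightarrow> ('a::real_normed_vector \<Rightarrow> 'b::real_normed_vector) \<Rightarrow> 'a set \<Rightarrow> bool" where
  "Ck_on 0 f U \<longleftrightarrow> continuous_on U f"
| "Ck_on (Suc k) f U \<longleftrightarrow>
     f differentiable_on U \<and> (\<forall>v. Ck_on k (\<lambda>u. frechet_derivative f (at u) v) U)"

text \<open>Only meaningful for open \<open>U\<close>: the derivatives are taken in the full space.\<close>
definition smooth_on :: "('a::real_normed_vector \<Rightarrow> 'b::real_normed_vector) \<Rightarrow> 'a set \<Rightarrow> bool" where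
  "smooth_on f U \<longleftrightarrow> (\<forall>k. Ck_on k f U)"


section \<open>The Heisenberg group\<close>

text \<open>Points of the Heisenberg group, and tangent vectors at any point, are written in the
  coordinates \<open>(x, y, z)\<close>, respectively in the basis of the coordinate fields.\<close>
type_synonym heis = "real \<times> real \<times> real"

fun E1 :: "heis \<Rightarrow> heis" where
  "E1 (x, y, z) = (1, 0, y)"

fun E2 :: "heis \<Rightarrow> heis" where
  "E2 (x, y, z) = (0, 1, - x)"

definition T_field :: "heis \<Rightarrow> heis" where
  "T_field p = (0, 0, 1)"

fun contact_form :: "heis \<Rightarrow> heis \<Rightarrow> real" where
  "contact_form (x, y, z) (v1, v2, v3) = v3 + x * v2 - y * v1"

definition contact_plane :: "heis \<Rightarrow> heis set" where
  "contact_plane p = {v. contact_form p v = 0}"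

text \<open>The coframe dual to \<open>E1\<close>, \<open>E2\<close>, \<open>T_field\<close> is \<open>dx\<close>, \<open>dy\<close>, \<open>contact_form\<close>.\<close>
lemma heis_frame_expansion:
  "v = fst v *\<^sub>R E1 p + fst (snd v) *\<^sub>R E2 p + contact_form p v *\<^sub>R T_field p"
  by (cases p; cases v) (simp add: T_field_def algebra_simps)

definition adapted_metric :: "heis \<Rightarrow> heis \<Rightarrow> heis \<Rightarrow> real" where
  "adapted_metric p v w =
     fst v * fst w + fst (snd v) * fst (snd w) + contact_form p v * contact_form p w"

lemma adapted_metric_orthonormal:
  "adapted_metric p (E1 p) (E1 p) = 1" "adapted_metric p (E2 p) (E2 p) = 1"
  "adapted_metric p (T_field p) (T_field p) = 1"
  "adapted_metric p (E1 p) (E2 p) = 0" "adapted_metric p (E1 p) (T_field p) = 0"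
  "adapted_metric p (E2 p) (T_field p) = 0"
  by (cases p; simp add: adapted_metric_def T_field_def)+

text \<open>\<open>J\<close> is only used on the contact plane; the formula extends it by \<open>J T = 0\<close>.\<close>
definition J :: "heis \<Rightarrow> heis \<Rightarrow> heis" where
  "J p v = fst v *\<^sub>R E2 p - fst (snd v) *\<^sub>R E1 p"

lemma J_frame: "J p (E1 p) = E2 p" "J p (E2 p) = - E1 p"
  by (cases p; simp add: J_def)+

text \<open>Covariant derivative, in the direction \<open>v\<close> at \<open>u\<close>, of a vector field \<open>W\<close> along the map \<open>X\<close>
  (that is, \<open>W u\<close> is a tangent vector at \<open>X u\<close>), for the connection that makes \<open>E1\<close>, \<open>E2\<close>,
  \<open>T_field\<close> parallel: the coefficients of \<open>W\<close> in this frame are differentiated.\<close>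
definition cov_deriv ::
  "('a::real_normed_vector \<Rightarrow> heis) \<Rightarrow> ('a \<Rightarrow> heis) \<Rightarrow> 'a \<Rightarrow> 'a \<Rightarrow> heis" where
  "cov_deriv X W u v =
     frechet_derivative (\<lambda>s. fst (W s)) (at u) v *\<^sub>R E1 (X u)
   + frechet_derivative (\<lambda>s. fst (snd (W s))) (at u) v *\<^sub>R E2 (X u)
   + frechet_derivative (\<lambda>s. contact_form (X s) (W s)) (at u) v *\<^sub>R T_field (X u)"


section \<open>Surfaces in the Heisenberg group\<close>

text \<open>A surface is given in a local coordinate system \<open>X\<close> on an open set \<open>U\<close> of the plane.
  Fields on the surface are fields along \<open>X\<close>, and functions on it are functions of the
  coordinates in \<open>U\<close>. As \<open>X\<close> need not be injective, immersed surfaces are included.\<close>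

abbreviation tangent_map :: "(real \<times> real \<Rightarrow> heis) \<Rightarrow> real \<times> real \<Rightarrow> real \<times> real \<Rightarrow> heis" where
  "tangent_map X u \<equiv> frechet_derivative X (at u)"

definition tangent_plane :: "(real \<times> real \<Rightarrow> heis) \<Rightarrow> real \<times> real \<Rightarrow> heis set" where
  "tangent_plane X u = range (tangent_map X u)"

definition surface :: "(real \<times> real) set \<Rightarrow> (real \<times> real \<Rightarrow> heis) \<Rightarrow> bool" where
  "surface U X \<longleftrightarrow> open U \<and> smooth_on X U \<and> (\<forall>u\<in>U. inj (tangent_map X u))"

definition singular_point :: "(real \<times> real \<Rightarrow> heis) \<Rightarrow> real \<times> real \<Rightarrow> bool" where
  "singular_point X u \<longleftrightarrow> tangent_plane X u = contact_plane (X u)"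

definition characteristic_field ::
  "(real \<times> real) set \<Rightarrow> (real \<times> real \<Rightarrow> heis) \<Rightarrow> (real \<times> real \<Rightarrow> heis) \<Rightarrow> bool" where
  "characteristic_field U X e1 \<longleftrightarrow> smooth_on e1 U \<and>
     (\<forall>u\<in>U. e1 u \<in> tangent_plane X u \<inter> contact_plane (X u)
            \<and> adapted_metric (X u) (e1 u) (e1 u) = 1)"

definition e2_field :: "(real \<times> real \<Rightarrow> heis) \<Rightarrow> (real \<times> real \<Rightarrow> heis) \<Rightarrow> real \<times> real \<Rightarrow> heis" where
  "e2_field X e1 u = J (X u) (e1 u)"

text \<open>\<open>\<nabla>\<^sub>e\<^sub>1 e2 = - H e1\<close>; here \<open>v\<close> is the coordinate vector that represents the tangent
  vector \<open>e1 u\<close>.\<close>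
definition p_mean_curvature ::
  "(real \<times> real) set \<Rightarrow> (real \<times> real \<Rightarrow> heis) \<Rightarrow> (real \<times> real \<Rightarrow> heis) \<Rightarrow> (real \<times> real \<Rightarrow> real) \<Rightarrow> bool"
  where
  "p_mean_curvature U X e1 H \<longleftrightarrow>
     (\<forall>u\<in>U. \<forall>v. tangent_map X u v = e1 u \<longrightarrow> cov_deriv X (e2_field X e1) u v = - H u *\<^sub>R e1 u)"

definition p_minimal ::
  "(real \<times> real) set \<Rightarrow> (real \<times> real \<Rightarrow> heis) \<Rightarrow> (real \<times> real \<Rightarrow> heis) \<Rightarrow> bool" where
  "p_minimal U X e1 \<longleftrightarrow> p_mean_curvature U X e1 (\<lambda>u. 0)"

definition alpha_function ::
  "(real \<times> real) set \<Rightarrow> (real \<times> real \<Rightarrow> heis) \<Rightarrow> (real \<times> real \<Rightarrow> heis) \<Rightarrow> (real \<times> real \<Rightarrow> real) \<Rightarrow> bool"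
  where
  "alpha_function U X e1 \<alpha> \<longleftrightarrow> smooth_on \<alpha> U \<and>
     (\<forall>u\<in>U. \<alpha> u *\<^sub>R e2_field X e1 u + T_field (X u) \<in> tangent_plane X u)"

definition e2_hat ::
  "(real \<times> real \<Rightarrow> heis) \<Rightarrow> (real \<times> real \<Rightarrow> heis) \<Rightarrow> (real \<times> real \<Rightarrow> real) \<Rightarrow> real \<times> real \<Rightarrow> heis" where
  "e2_hat X e1 \<alpha> u =
     (1 / sqrt (1 + (\<alpha> u)\<^sup>2)) *\<^sub>R (\<alpha> u *\<^sub>R e2_field X e1 u + T_field (X u))"

definition compatible_coordinates ::
  "(real \<times> real) set \<Rightarrow> (real \<times> real \<Rightarrow> heis) \<Rightarrow> (real \<times> real \<Rightarrow> heis) \<Rightarrow> bool" where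
  "compatible_coordinates U X e1 \<longleftrightarrow> (\<forall>u\<in>U. e1 u = tangent_map X u (1, 0))"

text \<open>The induced metric is represented by \<open>a\<close>, \<open>b\<close>: the second frame field is
  \<open>a \<partial>\<^sub>x + b \<partial>\<^sub>y\<close>, where the coordinate fields are the images of \<open>(1, 0)\<close> and \<open>(0, 1)\<close>.\<close>
definition induced_metric_rep ::
  "(real \<times> real) set \<Rightarrow> (real \<times> real \<Rightarrow> heis) \<Rightarrow> (real \<times> real \<Rightarrow> heis) \<Rightarrow> (real \<times> real \<Rightarrow> real)
    \<Rightarrow> (real \<times> real \<Rightarrow> real) \<Rightarrow> (real \<times> real \<Rightarrow> real) \<Rightarrow> bool" where
  "induced_metric_rep U X e1 \<alpha> a b \<longleftrightarrow> smooth_on a U \<and> smooth_on b U \<and>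
     (\<forall>u\<in>U. e2_hat X e1 \<alpha> u = a u *\<^sub>R tangent_map X u (1, 0) + b u *\<^sub>R tangent_map X u (0, 1))"

text \<open>The first conjunct in the quantifier says that the quotient is defined. The set
  \<open>snd ` U\<close> is the range of the coordinate \<open>y\<close>.\<close>
definition special_type_II ::
  "(real \<times> real) set \<Rightarrow> (real \<times> real \<Rightarrow> real) \<Rightarrow> (real \<Rightarrow> real) \<Rightarrow> bool" where
  "special_type_II U \<alpha> c1 \<longleftrightarrow> smooth_on c1 (snd ` U) \<and>
     (\<forall>(x, y)\<in>U. 2 * x + c1 y \<noteq> 0 \<and> \<alpha> (x, y) = 1 / (2 * x + c1 y))"

end

theory Submission
  imports Defs
begin

text \<open>
  By \<open>p\<close>-minimality the field \<open>e1\<close> is constant, as a vector of \<open>\<real>\<^sup>3\<close>, along the curves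
  \<open>y = const\<close>, so the surface is ruled by straight lines:
  \<open>X (x, y) = X (x0, y) + (x - x0) e1 (x0, y)\<close>. This gives the mixed derivatives of \<open>X\<close>
  explicitly. With \<open>f = \<Theta> (X\<^sub>y)\<close> and \<open>g\<close> the \<open>e1\<close>-component of \<open>X\<^sub>y\<close>, it follows that
  \<open>f\<^sub>x = 2 \<alpha> f\<close> and \<open>g\<^sub>x = 0\<close>, while comparing components in the definition of \<open>a\<close> and \<open>b\<close>
  gives \<open>b f = 1 / sqrt (1 + \<alpha>\<^sup>2)\<close> and \<open>a = - b g\<close>. For \<open>\<alpha> = 1 / (2 x + c1)\<close> the equation
  for \<open>f\<close> says that \<open>(2 x + c1) / f\<close> depends on \<open>y\<close> only. The functions \<open>h\<close> and \<open>k\<close> are smooth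
  because near each \<open>y\<close> they can be computed on a transversal \<open>x = const\<close>.
\<close>

section \<open>Calculus of smooth maps\<close>

text \<open>Derivatives at points of an open set depend only on nearby values, so agreement on
  \<open>U\<close> passes to all directional derivatives; hence the induction keeps \<open>f\<close>
  and \<open>g\<close> arbitrary.\<close>

lemma Ck_on_cong:
  assumes "open U" "\<And>u. u \<in> U \<Longrightarrow> f u = g u"
  shows "Ck_on k f U \<longleftrightarrow> Ck_on k g U"
  using assms(2)
proof (induction k arbitrary: f g)
  case 0
  then show ?case by (simp cong: continuous_on_cong)
next
  case (Suc k)
  have "(f has_derivative D) (at u) \<longleftrightarrow> (g has_derivative D) (at u)" if "u \<in> U" for u D
    using has_derivative_transform_within_open[of f D u UNIV U g]
      has_derivative_transform_within_open[of g D u UNIV U f] assms(1) that Suc.prems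
    by metis
  then have d: "f differentiable at u \<longleftrightarrow> g differentiable at u"
    and D: "frechet_derivative f (at u) = frechet_derivative g (at u)" if "u \<in> U" for u
    using that by (auto simp: differentiable_def frechet_derivative_def)
  have "Ck_on k (\<lambda>u. frechet_derivative f (at u) v) U
      \<longleftrightarrow> Ck_on k (\<lambda>u. frechet_derivative g (at u) v) U" for v
    by (rule Suc.IH) (simp add: D)
  with d show ?case
    using assms(1) by (simp add: differentiable_on_eq_differentiable_at)
qed

text \<open>Lets an explicit derivative formula \<open>f'\<close> stand in for
  \<open>frechet_derivative\<close>, by uniqueness of the derivative.\<close>

lemma Ck_on_SucI:
  assumes "open U" "\<And>u. u \<in> U \<Longrightarrow> (f has_derivative f' u) (at u)"
    and "\<And>v. Ck_on k (\<lambda>u. f' u v) U"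
  shows "Ck_on (Suc k) f U"
proof -
  have "Ck_on k (\<lambda>u. frechet_derivative f (at u) v) U" for v
    using assms(3)[of v] by (subst Ck_on_cong[OF assms(1)])
      (auto simp: frechet_derivative_at[OF assms(2)])
  moreover have "f differentiable_on U"
    using assms by (auto simp: differentiable_on_eq_differentiable_at differentiable_def)
  ultimately show ?thesis by simp
qed

lemma Ck_on_Suc_has_derivative:
  assumes "open U" "Ck_on (Suc k) f U" "u \<in> U"
  shows "(f has_derivative frechet_derivative f (at u)) (at u)"
  using assms by (simp add: differentiable_on_eq_differentiable_at frechet_derivative_works)

lemma Ck_on_SucD: "Ck_on (Suc k) f U \<Longrightarrow> Ck_on k f U"
  by (induction k arbitrary: f) (auto simp: differentiable_imp_continuous_on)

lemma Ck_on_const: "open U \<Longrightarrow> Ck_on k (\<lambda>u. c) U"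
proof (induction k arbitrary: c)
  case (Suc k)
  then show ?case by (intro Ck_on_SucI[where f' = "\<lambda>_ _. 0"]) auto
qed simp

text \<open>Serves to glue functions of \<open>y\<close> that are computed near each point on a
  different transversal.\<close>

lemma Ck_on_local:
  assumes "open U" "\<And>u. u \<in> U \<Longrightarrow> \<exists>V. open V \<and> u \<in> V \<and> Ck_on k f V"
  shows "Ck_on k f U"
  using assms(2)
proof (induction k arbitrary: f)
  case 0
  then have "\<forall>u\<in>U. isCont f u"
    by (metis Ck_on.simps(1) continuous_on_eq_continuous_at)
  then show ?case by (simp add: continuous_at_imp_continuous_on)
next
  case (Suc k)
  have "\<forall>u\<in>U. f differentiable at u"
    using Suc.prems by (metis Ck_on.simps(2) differentiable_on_eq_differentiable_at)
  moreover have "Ck_on k (\<lambda>u. frechet_derivative f (at u) v) U" for v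
    by (rule Suc.IH) (use Suc.prems in fastforce)
  ultimately show ?case
    using assms(1) by (simp add: differentiable_on_eq_differentiable_at)
qed

lemma Ck_on_add:
  assumes "open U"
  shows "Ck_on k f U \<Longrightarrow> Ck_on k g U \<Longrightarrow> Ck_on k (\<lambda>u. f u + g u) U"
proof (induction k arbitrary: f g)
  case 0
  then show ?case by (simp add: continuous_on_add)
next
  case (Suc k)
  show ?case
    by (rule Ck_on_SucI[OF assms has_derivative_add
          [OF Suc.prems[THEN Ck_on_Suc_has_derivative[OF assms]]]])
      (assumption, assumption, (rule Suc.IH; use Suc.prems in simp))
qed

lemma Ck_on_mult:
  fixes f g :: "'a::real_normed_vector \<Rightarrow> real"
  assumes "open U"
  shows "Ck_on k f U \<Longrightarrow> Ck_on k g U \<Longrightarrow> Ck_on k (\<lambda>u. f u * g u) U"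
proof (induction k arbitrary: f g)
  case 0
  then show ?case by (simp add: continuous_on_mult)
next
  case (Suc k)
  note C = Suc.prems[THEN Ck_on_SucD]
  show ?case
    by (rule Ck_on_SucI[OF assms has_derivative_mult
          [OF Suc.prems[THEN Ck_on_Suc_has_derivative[OF assms]]]])
      (assumption, assumption, (rule Ck_on_add[OF assms]; rule Suc.IH; use Suc.prems C in simp))
qed

text \<open>By the chain rule a directional derivative of the composite is that of \<open>f\<close>
  times the derivative of \<open>\<phi>\<close> composed with the same \<open>f\<close>, so the
  induction varies only \<open>\<phi>\<close>.\<close>

lemma Ck_on_compose_real:
  fixes \<phi> :: "real \<Rightarrow> real"
  assumes "open U" "open V" "f ` U \<subseteq> V"
  shows "Ck_on k \<phi> V \<Longrightarrow> Ck_on k f U \<Longrightarrow> Ck_on k (\<lambda>u. \<phi> (f u)) U"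
proof (induction k arbitrary: \<phi>)
  case 0
  then show ?case using assms(3) by (auto intro: continuous_on_compose2)
next
  case (Suc k)
  show ?case
  proof (rule Ck_on_SucI[OF assms(1)])
    fix u assume u: "u \<in> U"
    let ?D = "frechet_derivative \<phi> (at (f u))"
    have \<phi>: "(\<phi> has_derivative ?D) (at (f u))"
      using Ck_on_Suc_has_derivative[OF assms(2) Suc.prems(1)] u assms(3) by auto
    \<comment> \<open>A linear map on the reals is multiplication by its value at 1; this gives the
      product form needed for \<open>Ck_on_mult\<close>.\<close>
    have D: "?D r = r * ?D 1" for r
      using linear_scale[OF has_derivative_linear[OF \<phi>], of r 1] by simp
    show "((\<lambda>u. \<phi> (f u)) has_derivative
        (\<lambda>v. frechet_derivative f (at u) v * ?D 1)) (at u)"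
      using has_derivative_compose[OF Ck_on_Suc_has_derivative[OF assms(1) Suc.prems(2) u] \<phi>]
      by (subst (asm) D)
  next
    show "Ck_on k (\<lambda>u. frechet_derivative f (at u) v * frechet_derivative \<phi> (at (f u)) 1) U" for v
      by (rule Ck_on_mult[OF assms(1)]; (rule Suc.IH)?)
        (use Suc.prems Suc.prems(2)[THEN Ck_on_SucD] in simp_all)
  qed
qed

section \<open>Reciprocal, logarithm and square root\<close>

lemma Ck_on_real_SucI:
  fixes f :: "real \<Rightarrow> real"
  assumes "open U" "\<And>u. u \<in> U \<Longrightarrow> (f has_real_derivative f' u) (at u)" "Ck_on k f' U"
  shows "Ck_on (Suc k) f U"
proof (rule Ck_on_SucI[OF assms(1)])
  show "(f has_derivative (\<lambda>v. f' u * v)) (at u)" if "u \<in> U" for u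
    using assms(2)[OF that] by (simp add: has_field_derivative_def)
  show "Ck_on k (\<lambda>u. f' u * v) U" for v
    by (intro Ck_on_mult Ck_on_const assms)
qed

text \<open>The derivative is minus the square of the function itself, so the induction closes under
  products.\<close>

lemma Ck_on_inverse: "Ck_on k inverse {(0::real)<..}"
proof (induction k)
  case 0
  show ?case by (auto intro!: continuous_intros)
next
  case (Suc k)
  have "Ck_on k (\<lambda>x::real. (- 1) * (inverse x * inverse x)) {0<..}"
    by (intro Ck_on_mult Ck_on_const Suc) auto
  then show ?case
    by (rule Ck_on_real_SucI[rotated 2]) (auto intro!: derivative_eq_intros simp: field_simps)
qed

lemma Ck_on_ln: "Ck_on k ln {(0::real)<..}"
proof (cases k)
  case 0
  then show ?thesis by (auto intro!: continuous_intros)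
next
  case (Suc j)
  have "Ck_on (Suc j) ln {(0::real)<..}"
    by (rule Ck_on_real_SucI[OF _ _ Ck_on_inverse])
      (auto intro!: derivative_eq_intros simp: field_simps)
  then show ?thesis using Suc by simp
qed

lemma Ck_on_sqrt: "Ck_on k sqrt {0<..}"
proof (induction k)
  case 0
  show ?case by (auto intro!: continuous_intros)
next
  case (Suc k)
  \<comment> \<open>This is the derivative of the root: \<open>Ck_on_inverse\<close> composed with
    the induction hypothesis.\<close>
  have "Ck_on k (\<lambda>x. inverse (sqrt x) * (1/2)) {0<..}"
    by (intro Ck_on_mult Ck_on_const Ck_on_compose_real[OF _ _ _ Ck_on_inverse Suc]) auto
  then show ?case
    by (rule Ck_on_real_SucI[rotated 2]) (auto intro!: derivative_eq_intros simp: field_simps)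
qed

section \<open>Restriction to coordinate lines and descent to functions of \<open>y\<close>\<close>

lemma has_derivative_slice_snd:
  assumes "(f has_derivative f') (at (x, y))"
  shows "((\<lambda>s. f (x, s)) has_derivative (\<lambda>v. f' (0, v))) (at y)"
  by (rule has_derivative_compose[of "\<lambda>s. (x, s)"])
    (auto intro!: derivative_eq_intros assms)

lemma has_derivative_slice_fst:
  assumes "(f has_derivative f') (at (x, y))"
  shows "((\<lambda>s. f (s, y)) has_derivative (\<lambda>v. f' (v, 0))) (at x)"
  by (rule has_derivative_compose[of "\<lambda>s. (s, y)"])
    (auto intro!: derivative_eq_intros assms)

lemma open_slice_fst: "open U \<Longrightarrow> open {x. (x, y) \<in> U}"
  using open_vimage[of U "\<lambda>x. (x, y)"] by (simp add: vimage_def continuous_on_Pair)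

lemma open_slice_snd: "open U \<Longrightarrow> open {y. (x, y) \<in> U}"
  using open_vimage[of U "\<lambda>y. (x, y)"] by (simp add: vimage_def continuous_on_Pair)

lemma Ck_on_slice:
  assumes "open U"
  shows "Ck_on k f U \<Longrightarrow> Ck_on k (\<lambda>y. f (x, y)) {y. (x, y) \<in> U}"
proof (induction k arbitrary: f)
  case 0
  then show ?case
    by (auto intro!: continuous_on_compose2[of U f] continuous_intros)
next
  case (Suc k)
  show ?case
    by (rule Ck_on_SucI[OF open_slice_snd[OF assms]
          has_derivative_slice_snd[OF Ck_on_Suc_has_derivative[OF assms Suc.prems]]])
      (use Suc in auto)
qed

text \<open>The \<open>x\<close> picked by \<open>SOME\<close> may jump with \<open>y\<close>, but
  constancy along slices makes the choice irrelevant: near a given \<open>y\<close> one fixed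
  \<open>x\<close> serves because \<open>U\<close> is open, and there \<open>h\<close> is a slice of
  \<open>F\<close>.\<close>

lemma smooth_on_leaf_space:
  fixes F :: "real \<times> real \<Rightarrow> 'b::real_normed_vector"
  assumes U: "open U" and F: "smooth_on F U"
    and const: "\<And>x x' y. (x, y) \<in> U \<Longrightarrow> (x', y) \<in> U \<Longrightarrow> F (x, y) = F (x', y)"
  shows "\<exists>h. smooth_on h (snd ` U) \<and> (\<forall>x y. (x, y) \<in> U \<longrightarrow> F (x, y) = h y)"
proof -
  define h where "h y = F (SOME x. (x, y) \<in> U, y)" for y
  have h: "F (x, y) = h y" if "(x, y) \<in> U" for x y
    unfolding h_def using const[OF that someI[of "\<lambda>x. (x, y) \<in> U", OF that]] .
  have "smooth_on h (snd ` U)"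
    unfolding smooth_on_def
  proof
    fix k
    show "Ck_on k h (snd ` U)"
    proof (rule Ck_on_local[OF open_image_snd[OF U]])
      fix y assume "y \<in> snd ` U"
      then obtain x where x: "(x, y) \<in> U" by auto
      let ?V = "{y. (x, y) \<in> U}"
      have "Ck_on k (\<lambda>y. F (x, y)) ?V"
        using F by (auto simp: smooth_on_def intro: Ck_on_slice[OF U])
      then have "Ck_on k h ?V"
        using Ck_on_cong[OF open_slice_snd[OF U], of x "\<lambda>y. F (x, y)" h k] h by auto
      then show "\<exists>V. open V \<and> y \<in> V \<and> Ck_on k h V"
        using x open_slice_snd[OF U] by blast
    qed
  qed
  with h show ?thesis by blast
qed

section \<open>Surfaces ruled by horizontal lines\<close>

lemma contact_form_eq:
  "contact_form p v = snd (snd v) + fst p * fst (snd v) - fst (snd p) * fst v"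
  by (cases p; cases v) simp

lemma e2_field_eq:
  "e2_field X e1 u = (- fst (snd (e1 u)), fst (e1 u),
     - fst (e1 u) * fst (X u) - fst (snd (e1 u)) * fst (snd (X u)))"
  by (cases "X u") (simp add: e2_field_def J_def)

lemma smooth_on_has_derivative:
  assumes "open U" "smooth_on f U" "u \<in> U"
  shows "(f has_derivative frechet_derivative f (at u)) (at u)"
proof -
  have "Ck_on (Suc 0) f U" using assms(2) by (simp only: smooth_on_def)
  then show ?thesis using Ck_on_Suc_has_derivative[OF assms(1) _ assms(3)] by blast
qed

locale pminimal_chart =
  fixes U :: "(real \<times> real) set" and X e1 :: "real \<times> real \<Rightarrow> heis"
  assumes surface: "surface U X"
    and characteristic: "characteristic_field U X e1"
    and minimal: "p_minimal U X e1"
    and compatible: "compatible_coordinates U X e1"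
    and connected_slice: "connected {x. (x, y) \<in> U}"
begin

section \<open>Contact and unit-length relations, with their derivatives\<close>

lemma open_U: "open U"
  using surface by (simp add: surface_def)

lemma X_deriv: "u \<in> U \<Longrightarrow> (X has_derivative tangent_map X u) (at u)"
  using surface by (intro smooth_on_has_derivative) (auto simp: surface_def)

lemma e1_deriv: "u \<in> U \<Longrightarrow> (e1 has_derivative frechet_derivative e1 (at u)) (at u)"
  using characteristic open_U by (intro smooth_on_has_derivative) (auto simp: characteristic_field_def)

lemma X_deriv_fst: "u \<in> U \<Longrightarrow> tangent_map X u (1, 0) = e1 u"
  using compatible by (simp add: compatible_coordinates_def)

lemma e1_contact:
  "u \<in> U \<Longrightarrow> snd (snd (e1 u)) = fst (e1 u) * fst (snd (X u)) - fst (snd (e1 u)) * fst (X u)"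
  using characteristic contact_form_eq[of "X u" "e1 u"]
  by (auto simp: characteristic_field_def contact_plane_def algebra_simps)

lemma e1_unit: "u \<in> U \<Longrightarrow> fst (e1 u) * fst (e1 u) + fst (snd (e1 u)) * fst (snd (e1 u)) = 1"
  using characteristic
  by (auto simp: characteristic_field_def contact_plane_def adapted_metric_def)

text \<open>Obtained by differentiating \<open>e1_contact\<close>. It recovers the third component
  of the derivative of \<open>e1\<close> from the other two.\<close>

lemma e1_contact_deriv:
  assumes u: "u \<in> U"
  shows "snd (snd (frechet_derivative e1 (at u) v)) =
      fst (frechet_derivative e1 (at u) v) * fst (snd (X u))
    + fst (e1 u) * fst (snd (tangent_map X u v))
    - fst (snd (frechet_derivative e1 (at u) v)) * fst (X u)
    - fst (snd (e1 u)) * fst (tangent_map X u v)"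
proof -
  have *: "((\<lambda>s. fst (e1 s) * fst (snd (X s)) - fst (snd (e1 s)) * fst (X s)) has_derivative
     (\<lambda>v. snd (snd (frechet_derivative e1 (at u) v)))) (at u)"
    by (rule has_derivative_transform_within_open[OF _ open_U u e1_contact])
      (intro has_derivative_snd e1_deriv u)
  have "((\<lambda>s. fst (e1 s) * fst (snd (X s)) - fst (snd (e1 s)) * fst (X s)) has_derivative
     (\<lambda>v. (fst (e1 u) * fst (snd (tangent_map X u v))
         + fst (frechet_derivative e1 (at u) v) * fst (snd (X u)))
       - (fst (snd (e1 u)) * fst (tangent_map X u v)
         + fst (snd (frechet_derivative e1 (at u) v)) * fst (X u)))) (at u)"
    by (intro has_derivative_fst has_derivative_snd has_derivative_diff has_derivative_mult
        e1_deriv X_deriv u)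
  from fun_cong[OF has_derivative_unique[OF * this], of v] show ?thesis
    by (simp add: algebra_simps)
qed

lemma e1_unit_deriv:
  assumes u: "u \<in> U"
  shows "fst (e1 u) * fst (frechet_derivative e1 (at u) v)
    + fst (snd (e1 u)) * fst (snd (frechet_derivative e1 (at u) v)) = 0"
proof -
  have *: "((\<lambda>s. fst (e1 s) * fst (e1 s) + fst (snd (e1 s)) * fst (snd (e1 s))) has_derivative
     (\<lambda>v. 0)) (at u)"
    by (rule has_derivative_transform_within_open[OF _ open_U u e1_unit[symmetric]]) auto
  have "((\<lambda>s. fst (e1 s) * fst (e1 s) + fst (snd (e1 s)) * fst (snd (e1 s))) has_derivative
     (\<lambda>v. (fst (e1 u) * fst (frechet_derivative e1 (at u) v)
         + fst (frechet_derivative e1 (at u) v) * fst (e1 u))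
       + (fst (snd (e1 u)) * fst (snd (frechet_derivative e1 (at u) v))
         + fst (snd (frechet_derivative e1 (at u) v)) * fst (snd (e1 u))))) (at u)"
    by (intro has_derivative_fst has_derivative_snd has_derivative_add has_derivative_mult
        e1_deriv u)
  from fun_cong[OF has_derivative_unique[OF * this], of v] show ?thesis
    by (simp add: algebra_simps)
qed

text \<open>The first two coefficients of \<open>e2\<close> in the parallel frame are those of
  \<open>e1\<close> up to order and sign, so p-minimality makes them stationary along
  \<open>e1\<close>. In the third component the remaining terms of \<open>e1_contact_deriv\<close>
  cancel because the \<open>x\<close>-derivative of \<open>X\<close> is \<open>e1\<close>.\<close>

lemma e1_deriv_fst:
  assumes u: "u \<in> U"
  shows "frechet_derivative e1 (at u) (1, 0) = 0"
proof -
  let ?D = "frechet_derivative e1 (at u)"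
  have p: "frechet_derivative (\<lambda>s. fst (e1 s)) (at u) = (\<lambda>v. fst (?D v))"
    by (rule frechet_derivative_at[symmetric]) (intro has_derivative_fst e1_deriv u)
  have q: "frechet_derivative (\<lambda>s. - fst (snd (e1 s))) (at u) = (\<lambda>v. - fst (snd (?D v)))"
    by (rule frechet_derivative_at[symmetric])
      (intro has_derivative_minus has_derivative_fst has_derivative_snd e1_deriv u)
  have "cov_deriv X (e2_field X e1) u (1, 0) = 0"
    using minimal X_deriv_fst[OF u] u by (auto simp: p_minimal_def p_mean_curvature_def)
  then have "fst (?D (1, 0)) = 0 \<and> fst (snd (?D (1, 0))) = 0"
    by (cases "X u") (simp add: cov_deriv_def e2_field_eq p q T_field_def zero_prod_def)
  with e1_contact_deriv[OF u, of "(1, 0)"] show ?thesis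
    by (simp add: X_deriv_fst[OF u] prod_eq_iff)
qed

section \<open>Straight rulings and mixed derivatives\<close>

lemma e1_slice_const:
  assumes "(x, y) \<in> U" "(x', y) \<in> U"
  shows "e1 (x, y) = e1 (x', y)"
proof (rule has_derivative_zero_unique_connected
    [OF open_slice_fst[OF open_U] connected_slice, where f = "\<lambda>x. e1 (x, y)" and y1 = y])
  fix s assume "s \<in> {x. (x, y) \<in> U}"
  then have s: "(s, y) \<in> U" by simp
  have "frechet_derivative e1 (at (s, y)) (v, 0) = 0" for v
    using linear_scale[OF has_derivative_linear[OF e1_deriv[OF s]], of v "(1, 0)"]
    by (simp add: e1_deriv_fst[OF s])
  with has_derivative_slice_fst[OF e1_deriv[OF s]]
  show "((\<lambda>x. e1 (x, y)) has_derivative (\<lambda>v. 0)) (at s)" by simp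
qed (use assms in auto)

lemma ruled:
  assumes "(x, y) \<in> U" "(x0, y) \<in> U"
  shows "X (x, y) = X (x0, y) + (x - x0) *\<^sub>R e1 (x0, y)"
proof -
  \<comment> \<open>The zero term \<open>x0 - x0\<close> makes both sides values of one function of
    \<open>x\<close>, whose derivative vanishes on the connected slice.\<close>
  have "X (x, y) - (x - x0) *\<^sub>R e1 (x0, y) = X (x0, y) - (x0 - x0) *\<^sub>R e1 (x0, y)"
  proof (rule has_derivative_zero_unique_connected
      [OF open_slice_fst[OF open_U] connected_slice,
        where f = "\<lambda>x. X (x, y) - (x - x0) *\<^sub>R e1 (x0, y)" and y1 = y])
    fix s assume "s \<in> {x. (x, y) \<in> U}"
    then have s: "(s, y) \<in> U" by simp
    have "tangent_map X (s, y) (v, 0) = v *\<^sub>R e1 (x0, y)" for v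
      using linear_scale[OF has_derivative_linear[OF X_deriv[OF s]], of v "(1, 0)"]
      by (simp add: X_deriv_fst[OF s] e1_slice_const[OF s assms(2)])
    then show "((\<lambda>x. X (x, y) - (x - x0) *\<^sub>R e1 (x0, y)) has_derivative (\<lambda>v. 0)) (at s)"
      by (auto intro!: derivative_eq_intros has_derivative_slice_fst[OF X_deriv[OF s]])
  qed (use assms in auto)
  then show ?thesis by (simp add: algebra_simps)
qed

lemma X_deriv_snd_ruled:
  assumes "(x, y) \<in> U" "(x0, y) \<in> U"
  shows "tangent_map X (x, y) (0, 1) =
    tangent_map X (x0, y) (0, 1) + (x - x0) *\<^sub>R frechet_derivative e1 (at (x0, y)) (0, 1)"
proof -
  \<comment> \<open>\<open>ruled\<close> needs both end points in \<open>U\<close>, so the two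
    transversals are compared only for those \<open>s\<close> at which both lie in the
    domain.\<close>
  let ?V = "{s. (x, s) \<in> U} \<inter> {s. (x0, s) \<in> U}"
  have "((\<lambda>s. X (x, s)) has_derivative (\<lambda>v. tangent_map X (x0, y) (0, v)
      + (x - x0) *\<^sub>R frechet_derivative e1 (at (x0, y)) (0, v))) (at y)"
  proof (rule has_derivative_transform_within_open[where s = ?V])
    show "((\<lambda>s. X (x0, s) + (x - x0) *\<^sub>R e1 (x0, s)) has_derivative
       (\<lambda>v. tangent_map X (x0, y) (0, v)
         + (x - x0) *\<^sub>R frechet_derivative e1 (at (x0, y)) (0, v))) (at y)"
      by (intro has_derivative_add has_derivative_scaleR_right has_derivative_slice_snd
          X_deriv e1_deriv assms)
  qed (use assms open_slice_snd[OF open_U] in \<open>auto intro: ruled[symmetric]\<close>)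
  from has_derivative_unique[OF this has_derivative_slice_snd[OF X_deriv[OF assms(1)]]]
  show ?thesis by (auto dest: fun_cong[where x = 1])
qed

text \<open>Takes the place of interchanging second derivatives: by
  \<open>X_deriv_snd_ruled\<close>, based at \<open>x\<close> itself, the
  \<open>y\<close>-derivative of \<open>X\<close> is affine in \<open>x\<close>.\<close>

lemma mixed_deriv:
  assumes u: "(x, y) \<in> U"
  shows "((\<lambda>s. tangent_map X (s, y) (0, 1)) has_vector_derivative
     frechet_derivative e1 (at (x, y)) (0, 1)) (at x)"
proof -
  have "((\<lambda>s. tangent_map X (x, y) (0, 1)
        + (s - x) *\<^sub>R frechet_derivative e1 (at (x, y)) (0, 1)) has_vector_derivative
     frechet_derivative e1 (at (x, y)) (0, 1)) (at x)"
    unfolding has_vector_derivative_def by (auto intro!: derivative_eq_intros)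
  then show ?thesis
    unfolding has_vector_derivative_def
    by (rule has_derivative_transform_within_open[OF _ open_slice_fst[OF open_U]])
      (use u in \<open>auto intro: X_deriv_snd_ruled[OF _ u, symmetric]\<close>)
qed

section \<open>Components of the \<open>y\<close>-derivative of \<open>X\<close> along a
  ruling\<close>

abbreviation contact_y :: "real \<times> real \<Rightarrow> real" where
  "contact_y u \<equiv> contact_form (X u) (tangent_map X u (0, 1))"

text \<open>The right side is \<open>d\<Theta>\<close> evaluated on \<open>e1\<close> and the
  \<open>y\<close>-derivative of \<open>X\<close>. One half comes from the moving coefficients of
  \<open>\<Theta>\<close>, the other from the mixed derivative through
  \<open>e1_contact_deriv\<close>.\<close>

lemma contact_y_deriv:
  assumes u: "(x, y) \<in> U"
  shows "((\<lambda>s. contact_y (s, y)) has_real_derivative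
      2 * (fst (e1 (x, y)) * fst (snd (tangent_map X (x, y) (0, 1)))
         - fst (snd (e1 (x, y))) * fst (tangent_map X (x, y) (0, 1)))) (at x)"
proof -
  have X': "((\<lambda>s. X (s, y)) has_derivative (\<lambda>t. t *\<^sub>R e1 (x, y))) (at x)"
    using has_derivative_slice_fst[OF X_deriv[OF u]]
      linear_scale[OF has_derivative_linear[OF X_deriv[OF u]], of _ "(1, 0)"]
    by (simp add: X_deriv_fst[OF u])
  note Y' = mixed_deriv[OF u, unfolded has_vector_derivative_def]
  show ?thesis
    unfolding contact_form_eq has_field_derivative_def
    by (rule derivative_eq_intros X' Y' refl)+
      (simp add: e1_contact_deriv[OF u] fun_eq_iff algebra_simps)
qed

text \<open>Along a ruling the \<open>y\<close>-derivative of \<open>X\<close> changes by a multiple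
  of the \<open>y\<close>-derivative of \<open>e1\<close>, which is orthogonal to \<open>e1\<close>
  in the first two components since \<open>e1\<close> has unit length.\<close>

lemma inner_y_slice_const:
  assumes "(x, y) \<in> U" "(x', y) \<in> U"
  shows "fst (e1 (x, y)) * fst (tangent_map X (x, y) (0, 1))
      + fst (snd (e1 (x, y))) * fst (snd (tangent_map X (x, y) (0, 1)))
    = fst (e1 (x', y)) * fst (tangent_map X (x', y) (0, 1))
      + fst (snd (e1 (x', y))) * fst (snd (tangent_map X (x', y) (0, 1)))"
proof -
  have "(x - x') * (fst (e1 (x', y)) * fst (frechet_derivative e1 (at (x', y)) (0, 1))
    + fst (snd (e1 (x', y))) * fst (snd (frechet_derivative e1 (at (x', y)) (0, 1)))) = 0"
    using e1_unit_deriv[OF assms(2), of "(0, 1)"] by simp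
  then show ?thesis
    unfolding X_deriv_snd_ruled[OF assms] e1_slice_const[OF assms]
    by (simp add: algebra_simps)
qed

text \<open>The contact term of \<open>adapted_metric\<close> is absent because \<open>e1\<close> is
  horizontal.\<close>

abbreviation inner_y :: "real \<times> real \<Rightarrow> real" where
  "inner_y u \<equiv> fst (e1 u) * fst (tangent_map X u (0, 1))
    + fst (snd (e1 u)) * fst (snd (tangent_map X u (0, 1)))"

text \<open>The three claims come from pairing the equation \<open>rep\<close> with
  \<open>\<Theta>\<close>, with \<open>e1\<close> and with \<open>e2\<close>. The first pairing
  kills the horizontal vectors \<open>e1\<close> and \<open>e2\<close>.\<close>

lemma metric_rep_components:
  assumes u: "u \<in> U"
    and rep: "e2_hat X e1 \<alpha> u = a *\<^sub>R tangent_map X u (1, 0) + b *\<^sub>R tangent_map X u (0, 1)"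
  shows "b * contact_y u = 1 / sqrt (1 + (\<alpha> u)\<^sup>2)"
    and "a = - b * inner_y u"
    and "b \<noteq> 0 \<Longrightarrow> fst (e1 u) * fst (snd (tangent_map X u (0, 1)))
      - fst (snd (e1 u)) * fst (tangent_map X u (0, 1)) = \<alpha> u * contact_y u"
proof -
  define s p q where "s = 1 / sqrt (1 + (\<alpha> u)\<^sup>2)" and "p = fst (e1 u)" and "q = fst (snd (e1 u))"
  obtain d1 d2 d3 where d: "tangent_map X u (0, 1) = (d1, d2, d3)" by (metis prod.exhaust)
  obtain x1 x2 x3 where X: "X u = (x1, x2, x3)" by (metis prod.exhaust)
  have e1: "e1 u = (p, q, p * x2 - q * x1)"
    using e1_contact[OF u] by (simp add: X p_def q_def prod_eq_iff)
  have pq: "p * p + q * q = 1" using e1_unit[OF u] by (simp add: p_def q_def)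
  have r: "- (s * \<alpha> u * q) = a * p + b * d1" "s * \<alpha> u * p = a * q + b * d2"
    "s * (\<alpha> u * (- p * x1 - q * x2) + 1) = a * (p * x2 - q * x1) + b * d3"
    using rep unfolding e2_hat_def s_def[symmetric] X_deriv_fst[OF u] d e2_field_eq T_field_def
    by (simp_all add: e1 X)
  have bf: "b * (d3 + x1 * d2 - x2 * d1) = s"
    using r by algebra
  then show "b * contact_y u = 1 / sqrt (1 + (\<alpha> u)\<^sup>2)"
    by (simp add: d X s_def)
  have "a = - b * (p * d1 + q * d2)"
    using r pq by algebra
  then show "a = - b * inner_y u"
    by (simp add: d p_def q_def)
  have "b * (p * d2 - q * d1) = s * \<alpha> u"
    using r pq by algebra
  \<comment> \<open>Replacing the normalising factor \<open>s\<close> by its value from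
    \<open>bf\<close> exposes \<open>b\<close> on both sides, ready for cancellation.\<close>
  also have "\<dots> = b * (\<alpha> u * (d3 + x1 * d2 - x2 * d1))"
    by (simp flip: bf)
  finally show "fst (e1 u) * fst (snd (tangent_map X u (0, 1)))
      - fst (snd (e1 u)) * fst (tangent_map X u (0, 1)) = \<alpha> u * contact_y u" if "b \<noteq> 0"
    using that by (simp add: d X p_def q_def)
qed

end

text \<open>Pull the square of \<open>t\<close> out of the root. The reciprocal of the factor in the
  theorem then involves no absolute value, so its smoothness is plain.\<close>

lemma abs_div_sqrt_one_plus_square:
  fixes t :: real
  assumes "t \<noteq> 0"
  shows "\<bar>t\<bar> / sqrt (1 + t\<^sup>2) * sqrt (1 + inverse (t * t)) = 1"
proof -
  have "1 + t\<^sup>2 = t\<^sup>2 * (1 + inverse (t * t))"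
    using assms by (simp add: field_simps power2_eq_square)
  then have "sqrt (1 + t\<^sup>2) = \<bar>t\<bar> * sqrt (1 + inverse (t * t))"
    by (simp add: real_sqrt_mult)
  moreover have "sqrt (1 + t\<^sup>2) > 0" by (simp add: add_pos_nonneg)
  ultimately show ?thesis by (metis divide_self_if less_irrefl times_divide_eq_left)
qed

theorem proposition5p5:
  fixes U :: "(real \<times> real) set" and X :: "real \<times> real \<Rightarrow> heis"
    and e1 :: "real \<times> real \<Rightarrow> heis"
    and \<alpha> a b :: "real \<times> real \<Rightarrow> real" and c1 :: "real \<Rightarrow> real"
  assumes "surface U X"
    and "\<forall>u\<in>U. \<not> singular_point X u"
    and "characteristic_field U X e1"
    and "p_minimal U X e1"
    and "alpha_function U X e1 \<alpha>"
    and "compatible_coordinates U X e1"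
    and "induced_metric_rep U X e1 \<alpha> a b"
    and "\<forall>u\<in>U. b u > 0"
    and "\<forall>y. connected {x. (x, y) \<in> U}"
    and "special_type_II U \<alpha> c1"
  shows "\<exists>h k :: real \<Rightarrow> real. smooth_on h (snd ` U) \<and> smooth_on k (snd ` U) \<and>
    (\<forall>(x, y)\<in>U.
       a (x, y) = \<bar>\<alpha> (x, y)\<bar> * h y / sqrt (1 + (\<alpha> (x, y))\<^sup>2) \<and>
       b (x, y) = \<bar>\<alpha> (x, y)\<bar> * exp (k y) / sqrt (1 + (\<alpha> (x, y))\<^sup>2))"
proof -
  interpret pminimal_chart U X e1
    using assms(1,3,4,6,9) by unfold_locales auto
  have \<alpha>_smooth: "smooth_on \<alpha> U" and ab_smooth: "smooth_on a U" "smooth_on b U"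
    and rep: "\<And>u. u \<in> U \<Longrightarrow>
      e2_hat X e1 \<alpha> u = a u *\<^sub>R tangent_map X u (1, 0) + b u *\<^sub>R tangent_map X u (0, 1)"
    using assms(5,7) by (auto simp: alpha_function_def induced_metric_rep_def)
  have b_pos: "b u > 0" if "u \<in> U" for u using assms(8) that by blast
  have \<alpha>: "2 * x + c1 y \<noteq> 0" "\<alpha> (x, y) = 1 / (2 * x + c1 y)" if "(x, y) \<in> U" for x y
    using assms(10) that by (auto simp: special_type_II_def)
  have \<alpha>_nz: "\<alpha> u \<noteq> 0" if "u \<in> U" for u
    using \<alpha> that by (cases u) auto
  have \<alpha>_sq_pos: "\<alpha> u * \<alpha> u > 0" if "u \<in> U" for u
    using \<alpha>_nz[OF that] not_real_square_gt_zero[of "\<alpha> u"] by blast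
  \<comment> \<open>\<open>w = sqrt (1 + \<alpha>\<^sup>2) / \<bar>\<alpha>\<bar>\<close>, in a form without \<open>\<bar>\<alpha>\<bar>\<close>\<close>
  define w where "w u = sqrt (1 + inverse (\<alpha> u * \<alpha> u))" for u
  have w: "\<bar>\<alpha> u\<bar> / sqrt (1 + (\<alpha> u)\<^sup>2) * w u = 1" if "u \<in> U" for u
    unfolding w_def using abs_div_sqrt_one_plus_square[OF \<alpha>_nz[OF that]] .
  have w_pos: "w u > 0" for u
    unfolding w_def by (simp add: add_pos_nonneg)
  have w_smooth: "smooth_on w U"
    unfolding smooth_on_def
  proof
    fix k
    have "Ck_on k \<alpha> U" using \<alpha>_smooth by (simp add: smooth_on_def)
    then have "Ck_on k (\<lambda>u. inverse (\<alpha> u * \<alpha> u)) U"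
      by (intro Ck_on_compose_real[OF open_U _ _ Ck_on_inverse] Ck_on_mult open_U)
        (use \<alpha>_sq_pos in auto)
    then have "Ck_on k (\<lambda>u. sqrt (1 + inverse (\<alpha> u * \<alpha> u))) U"
      by (intro Ck_on_compose_real[OF open_U _ _ Ck_on_sqrt] Ck_on_add Ck_on_const open_U)
        (auto simp: add_pos_nonneg)
    then show "Ck_on k w U" by (simp add: w_def[abs_def])
  qed

  \<comment> \<open>Quantities constant along the rulings\<close>
  have f_pos: "contact_y u > 0" if "u \<in> U" for u
  proof -
    have "b u * contact_y u > 0"
      unfolding metric_rep_components(1)[OF that rep[OF that]] by (simp add: add_pos_nonneg)
    then show ?thesis using b_pos[OF that] by (rule zero_less_mult_pos)
  qed
  have f_deriv: "((\<lambda>s. contact_y (s, y)) has_real_derivative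
      2 * (\<alpha> (x, y) * contact_y (x, y))) (at x)" if u: "(x, y) \<in> U" for x y
    using contact_y_deriv[OF u] metric_rep_components(3)[OF u rep[OF u]] b_pos[OF u] by simp
  \<comment> \<open>Both \<open>2 * x + c1 y\<close> and \<open>contact_y\<close> solve the linear
    equation with coefficient \<open>2 * \<alpha>\<close> in \<open>x\<close>, so their quotient is
    constant; \<open>f_pos\<close> makes it defined.\<close>
  have quot_const: "(2 * x + c1 y) / contact_y (x, y) = (2 * x' + c1 y) / contact_y (x', y)"
    if "(x, y) \<in> U" "(x', y) \<in> U" for x x' y
  proof (rule has_derivative_zero_unique_connected[OF open_slice_fst[OF open_U] connected_slice,
        where f = "\<lambda>x. (2 * x + c1 y) / contact_y (x, y)" and y1 = y])
    fix s assume "s \<in> {x. (x, y) \<in> U}"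
    then have s: "(s, y) \<in> U" by simp
    have "((\<lambda>x. (2 * x + c1 y) / contact_y (x, y)) has_real_derivative
        (2 * contact_y (s, y) - (2 * s + c1 y) * (2 * (\<alpha> (s, y) * contact_y (s, y))))
        / (contact_y (s, y) * contact_y (s, y))) (at s)"
      using f_pos[OF s] by (intro DERIV_divide f_deriv[OF s]) (auto intro!: derivative_eq_intros)
    moreover have "2 * contact_y (s, y) - (2 * s + c1 y) * (2 * (\<alpha> (s, y) * contact_y (s, y))) = 0"
      using \<alpha>[OF s] by simp
    ultimately show "((\<lambda>x. (2 * x + c1 y) / contact_y (x, y)) has_derivative (\<lambda>v. 0)) (at s)"
      by (simp add: has_field_derivative_def lambda_zero)
  qed (use that in auto)
  \<comment> \<open>Multiply the first claim of \<open>metric_rep_components\<close> by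
    \<open>\<bar>\<alpha>\<bar> * w\<close>, then use that \<open>\<bar>\<alpha>\<bar>\<close> is
    the reciprocal of \<open>\<bar>2 * x + c1 y\<bar>\<close> and that \<open>contact_y\<close> is
    positive.\<close>
  have bw: "b (x, y) * w (x, y) = \<bar>(2 * x + c1 y) / contact_y (x, y)\<bar>" if u: "(x, y) \<in> U" for x y
  proof -
    have "\<bar>\<alpha> (x, y)\<bar> * (b (x, y) * w (x, y) * contact_y (x, y)) = 1"
      using w[OF u] metric_rep_components(1)[OF u rep[OF u]] \<alpha>_nz[OF u] w_pos[of "(x, y)"]
      by (simp add: mult.assoc mult.commute[of "w (x, y)"] flip: mult.assoc[of "b (x, y)"])
    then show ?thesis
      using \<alpha>[OF u] f_pos[OF u] by (simp add: field_simps)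
  qed
  have bw_const: "b (x, y) * w (x, y) = b (x', y) * w (x', y)"
    if "(x, y) \<in> U" "(x', y) \<in> U" for x x' y
    using bw quot_const that by metis
  have aw_const: "a (x, y) * w (x, y) = a (x', y) * w (x', y)"
    if u: "(x, y) \<in> U" "(x', y) \<in> U" for x x' y
  proof -
    \<comment> \<open>Both factors on the right are constant along the ruling.\<close>
    have "a (x, y) * w (x, y) = - inner_y (x, y) * (b (x, y) * w (x, y))" if "(x, y) \<in> U" for x
      unfolding metric_rep_components(2)[OF that rep[OF that]] by (simp add: algebra_simps)
    then show ?thesis
      using inner_y_slice_const[OF u] bw_const[OF u] u by metis
  qed

  \<comment> \<open>Smooth functions \<open>h\<close> and \<open>k\<close> of
    \<open>y\<close>\<close>
  have aw_smooth: "smooth_on (\<lambda>u. a u * w u) U"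
    using ab_smooth w_smooth by (auto simp: smooth_on_def intro: Ck_on_mult open_U)
  obtain h where h: "smooth_on h (snd ` U)" "\<And>x y. (x, y) \<in> U \<Longrightarrow> a (x, y) * w (x, y) = h y"
    using smooth_on_leaf_space[OF open_U aw_smooth] aw_const by blast
  \<comment> \<open>Positivity of \<open>b * w\<close> allows descending its logarithm directly, so
    that \<open>k\<close> is smooth and \<open>exp (k y)\<close> returns
    \<open>b * w\<close>.\<close>
  have ln_smooth: "smooth_on (\<lambda>u. ln (b u * w u)) U"
    unfolding smooth_on_def
    using ab_smooth w_smooth b_pos w_pos
    by (auto simp: smooth_on_def
        intro!: Ck_on_compose_real[OF open_U _ _ Ck_on_ln] Ck_on_mult open_U)
  have ln_const: "ln (b (x, y) * w (x, y)) = ln (b (x', y) * w (x', y))"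
    if "(x, y) \<in> U" "(x', y) \<in> U" for x x' y
    using bw_const[OF that] by simp
  obtain k where k: "smooth_on k (snd ` U)"
      "\<And>x y. (x, y) \<in> U \<Longrightarrow> ln (b (x, y) * w (x, y)) = k y"
    using smooth_on_leaf_space[OF open_U ln_smooth] ln_const by blast
  \<comment> \<open>By \<open>w\<close>, dividing by \<open>w u\<close> amounts to multiplying by
    \<open>\<bar>\<alpha> u\<bar> / sqrt (1 + (\<alpha> u)\<^sup>2)\<close>.\<close>
  have rescale: "c = \<bar>\<alpha> u\<bar> * d / sqrt (1 + (\<alpha> u)\<^sup>2)" if "u \<in> U" "c * w u = d" for c d u
  proof -
    have "c = c * (\<bar>\<alpha> u\<bar> / sqrt (1 + (\<alpha> u)\<^sup>2) * w u)" by (subst w[OF that(1)]) simp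
    also have "\<dots> = \<bar>\<alpha> u\<bar> * d / sqrt (1 + (\<alpha> u)\<^sup>2)"
      by (simp add: mult_ac flip: that(2))
    finally show ?thesis .
  qed
  have bk: "b (x, y) * w (x, y) = exp (k y)" if "(x, y) \<in> U" for x y
    using k(2)[OF that, symmetric] b_pos[OF that] w_pos[of "(x, y)"] by simp
  show ?thesis
  proof (rule exI[of _ h], rule exI[of _ k], intro conjI h(1) k(1))
    show "\<forall>(x, y)\<in>U. a (x, y) = \<bar>\<alpha> (x, y)\<bar> * h y / sqrt (1 + (\<alpha> (x, y))\<^sup>2) \<and>
       b (x, y) = \<bar>\<alpha> (x, y)\<bar> * exp (k y) / sqrt (1 + (\<alpha> (x, y))\<^sup>2)"
      by (auto intro: rescale h(2) bk)
  qed
qed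

end
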